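(* There is an absolute constant $C>0$ such that the following holds. For every integer $k\geq 1$, every $\rho\in(0,1]$, every $\varepsilon\in(0,1]$ and $\delta\in(0,1)$, and every reference distribution $\mathbf{q}$ on $[k]$, there exists a public-coin $\rho$-LDP protocol for $(k,\varepsilon,\delta)$-identity testing in which each player sends a single bit, using $n=C\frac{k}{\varepsilon^2\rho^2}\log\frac{1}{\delta}$ players.
   Context: Notation: $[k]=\{1,\dots,k\}$; $d_{TV}(\mathbf{p},\mathbf{q})=\frac12\sum_x|\mathbf{p}(x)-\mathbf{q}(x)|$. A channel $W$ from a finite set $\mathcal{X}$ to a message set $\mathcal{Y}$ is $\rho$-locally differentially private ($\rho$-LDP) if $W(y\mid x')\leq e^{\rho}W(y\mid x)$ for all $y,x,x'$. Setting: $n$ players, player $i$ holds $X_i$, with $X_1,\dots,X_n$ i.i.d. from an unknown distribution $\mathbf{p}$ on $[k]$. In a public-coin (non-interactive) protocol there are private random variables $U_1,\dots,U_n$ and a shared random variable $V$, all mutually independent and independent of the samples; each player $i$ chooses a $\rho$-LDP channel $W_i$ as a function of $V$ (and possibly $U_i$) and simultaneously sends the message $Y_i$ obtained by passing $X_i$ through $W_i$ to a referee, who observes $(Y_1,\dots,Y_n)$ and $V$ (but not the $U_i$) and applies a (possibly randomized) map outputting accept or reject. One bit per player means $Y_i\in\{0,1\}$. The protocol solves $(k,\varepsilon,\delta)$-identity testing for the known reference $\mathbf{q}$ if it accepts with probability $>1-\delta$ when $\mathbf{p}=\mathbf{q}$ and rejects with probability $>1-\delta$ when $d_{TV}(\mathbf{p},\mathbf{q})>\varepsilon$.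 *)

theory Defs
  imports "HOL-Probability.Probability"
begin

text \<open>Distributions on \<open>[k]\<close> are the \<open>p :: nat pmf\<close> with \<open>set_pmf p \<subseteq> {1..k}\<close>.\<close>

definition d_TV :: "nat \<Rightarrow> nat pmf \<Rightarrow> nat pmf \<Rightarrow> real" where
  "d_TV k p q = 1 / 2 * (\<Sum>x=1..k. \<bar>pmf p x - pmf q x\<bar>)"

text \<open>For a channel \<open>W\<close>, \<open>pmf (W x) y\<close> is \<open>W(y | x)\<close>.\<close>

definition ldp_channel :: "real \<Rightarrow> 'x set \<Rightarrow> ('x \<Rightarrow> 'y pmf) \<Rightarrow> bool" where
  "ldp_channel \<rho> X W \<longleftrightarrow>
     (\<forall>y. \<forall>x\<in>X. \<forall>x'\<in>X. pmf (W x') y \<le> exp \<rho> * pmf (W x) y)"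

text \<open>
  \<open>pub_law P\<close> is the law of \<open>V\<close> and \<open>priv_law P i\<close> the law of \<open>U\<^sub>i\<close>. The channel of player
  \<open>i \<in> {1..players P}\<close> depends on \<open>(V, U\<^sub>i)\<close>, whereas the (randomized) referee gets only the
  messages and \<open>V\<close>; its outcome \<open>True\<close> means accept.
\<close>

record ('v, 'u, 'y) protocol =
  players :: nat
  pub_law :: "'v measure"
  priv_law :: "nat \<Rightarrow> 'u measure"
  channel :: "nat \<Rightarrow> 'v \<Rightarrow> 'u \<Rightarrow> nat \<Rightarrow> 'y pmf"
  referee :: "(nat \<Rightarrow> 'y) \<Rightarrow> 'v \<Rightarrow> bool pmf"

definition public_coin_ldp_protocol ::
  "nat \<Rightarrow> real \<Rightarrow> ('v, 'u, 'y::countable) protocol \<Rightarrow> bool" where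
  "public_coin_ldp_protocol k \<rho> P \<longleftrightarrow>
     prob_space (pub_law P) \<and>
     (\<forall>i\<in>{1..players P}. prob_space (priv_law P i)) \<and>
     (\<forall>i\<in>{1..players P}. \<forall>v\<in>space (pub_law P). \<forall>u\<in>space (priv_law P i).
        ldp_channel \<rho> {1..k} (channel P i v u)) \<and>
     (\<forall>i\<in>{1..players P}. \<forall>x\<in>{1..k}. \<forall>y.
        (\<lambda>(v, u). pmf (channel P i v u x) y)
          \<in> borel_measurable (pub_law P \<Otimes>\<^sub>M priv_law P i)) \<and>
     (\<forall>y. (\<lambda>v. pmf (referee P y v) True) \<in> borel_measurable (pub_law P))"

text \<open>Law of the referee's output for i.i.d. samples from \<open>p\<close>, given \<open>V = v\<close> and \<open>U = u\<close>.\<close>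

definition output_given ::
  "('v, 'u, 'y) protocol \<Rightarrow> nat pmf \<Rightarrow> 'v \<Rightarrow> (nat \<Rightarrow> 'u) \<Rightarrow> bool pmf" where
  "output_given P p v u =
     bind_pmf (Pi_pmf {1..players P} undefined (\<lambda>_. p)) (\<lambda>x.
     bind_pmf (Pi_pmf {1..players P} undefined (\<lambda>i. channel P i v (u i) (x i))) (\<lambda>y.
     referee P y v))"

text \<open>
  Integrating against the product law of \<open>V\<close> and \<open>U\<^sub>1, \<dots>, U\<^sub>n\<close> encodes that these are mutually
  independent and independent of the samples.
\<close>

definition output_prob :: "('v, 'u, 'y) protocol \<Rightarrow> nat pmf \<Rightarrow> bool \<Rightarrow> real" where
  "output_prob P p b =
     (\<integral>v. (\<integral>u. pmf (output_given P p v u) b \<partial>(\<Pi>\<^sub>M i\<in>{1..players P}. priv_law P i))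
        \<partial>(pub_law P))"

definition solves_identity_testing ::
  "nat \<Rightarrow> real \<Rightarrow> real \<Rightarrow> nat pmf \<Rightarrow> ('v, 'u, 'y) protocol \<Rightarrow> bool" where
  "solves_identity_testing k \<epsilon> \<delta> q P \<longleftrightarrow>
     output_prob P q True > 1 - \<delta> \<and>
     (\<forall>p. set_pmf p \<subseteq> {1..k} \<longrightarrow> d_TV k p q > \<epsilon> \<longrightarrow> output_prob P p False > 1 - \<delta>)"

end

theory Submission
  imports Defs
begin

text \<open>
  The first \<open>T * m\<close> players are split into \<open>T\<close> blocks of \<open>m\<close>. The public coin gives every block an
  independent uniform subset \<open>S\<close> of \<open>{1..k}\<close>, and a player holding \<open>x\<close> sends a noisy version of the
  bit \<open>x \<in> S\<close>, namely a Bernoulli bit of mean \<open>1/2 + \<rho>/4\<close> or \<open>1/2\<close>. If \<open>d_TV k p q > \<epsilon>\<close> then the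
  vector \<open>p - q\<close> has squared Euclidean norm at least \<open>4\<epsilon>\<^sup>2/k\<close>; comparing the second and fourth
  moments of its random signed sum shows that \<open>\<bar>p(S) - q(S)\<bar> \<ge> \<epsilon>/sqrt(2k)\<close> with probability at
  least \<open>2/21\<close>. When \<open>m\<close> is of order \<open>k/(\<epsilon>\<^sup>2\<rho>\<^sup>2)\<close>, counting the ones of the block detects this, so a
  block rejects with probability at most \<open>1/50\<close> under \<open>q\<close> and at least \<open>7/75\<close> under \<open>p\<close>. The
  verdicts of the blocks are i.i.d., hence by Hoeffding's inequality \<open>T\<close> of order \<open>ln (1/\<delta>)\<close> blocks
  suffice to separate the two cases. For \<open>\<delta> > 1/2\<close>, where \<open>n\<close> may be too small for a single block, a
  fair coin already solves the problem.
\<close>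

section \<open>Moments and anti-concentration of random signed sums\<close>

lemma sum_Pow_insert:
  fixes f :: "'a set \<Rightarrow> 'b::comm_monoid_add"
  assumes "finite A" "a \<notin> A"
  shows "sum f (Pow (insert a A)) = (\<Sum>S\<in>Pow A. f S + f (insert a S))"
proof -
  have "inj_on (insert a) (Pow A)"
    using assms(2) by (auto simp: inj_on_def)
  moreover have "Pow A \<inter> insert a ` Pow A = {}"
    using assms(2) by auto
  ultimately show ?thesis
    using assms(1) by (simp add: Pow_insert sum.union_disjoint sum.reindex sum.distrib)
qed

text \<open>For \<open>S \<subseteq> A\<close>, \<open>Z A S\<close> is the sum of the
  \<open>d x\<close> with sign plus on \<open>S\<close> and minus off \<open>S\<close>. A new
  element \<open>a\<close> turns \<open>Z\<close> into \<open>Z - d a\<close> or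
  \<open>Z + d a\<close>, and odd powers cancel between the two. Both moments share one induction
  because the fourth-moment step needs the second moment.\<close>

lemma signed_sum_moments:
  fixes d :: "'a \<Rightarrow> real"
  assumes "finite A"
  defines "Z \<equiv> \<lambda>A S. 2 * sum d S - sum d A"
  shows signed_sum_second_moment:
      "(\<Sum>S\<in>Pow A. (Z A S)\<^sup>2) = 2 ^ card A * (\<Sum>x\<in>A. (d x)\<^sup>2)"
    and signed_sum_fourth_moment:
      "(\<Sum>S\<in>Pow A. (Z A S) ^ 4) \<le> 2 ^ card A * (3 * (\<Sum>x\<in>A. (d x)\<^sup>2)\<^sup>2)"
  using assms(1)
proof (induction A rule: finite_induct)
  case empty
  {
    case 1 show ?case by (simp add: Z_def)
  next
    case 2 show ?case by (simp add: Z_def)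
  }
next
  case (insert a A)
  let ?M = "\<Sum>x\<in>A. (d x)\<^sup>2"
  have split: "(\<Sum>S\<in>Pow (insert a A). F (Z (insert a A) S))
      = (\<Sum>S\<in>Pow A. F (Z A S - d a) + F (Z A S + d a))" for F :: "real \<Rightarrow> real"
  proof -
    have "Z (insert a A) S = Z A S - d a \<and> Z (insert a A) (insert a S) = Z A S + d a"
      if "S \<in> Pow A" for S
    proof -
      have "finite S" "a \<notin> S"
        using that insert.hyps by (auto intro: finite_subset)
      then show ?thesis
        using insert.hyps by (simp add: Z_def)
    qed
    then show ?thesis
      using insert.hyps by (simp add: sum_Pow_insert)
  qed
  have card: "card (Pow A) = 2 ^ card A"
    using insert.hyps by (simp add: card_Pow)
  {
    case 1
    have "(\<Sum>S\<in>Pow (insert a A). (Z (insert a A) S)\<^sup>2)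
        = (\<Sum>S\<in>Pow A. (Z A S - d a)\<^sup>2 + (Z A S + d a)\<^sup>2)"
      by (rule split)
    also have "\<dots> = (\<Sum>S\<in>Pow A. 2 * (Z A S)\<^sup>2 + 2 * (d a)\<^sup>2)"
      by (simp add: power2_eq_square algebra_simps)
    also have "\<dots> = 2 * (\<Sum>S\<in>Pow A. (Z A S)\<^sup>2) + 2 ^ card A * (2 * (d a)\<^sup>2)"
      by (simp add: sum.distrib sum_distrib_left card)
    finally show ?case
      using insert by (simp add: algebra_simps)
  next
    case 2
    have "(\<Sum>S\<in>Pow (insert a A). (Z (insert a A) S) ^ 4)
        = (\<Sum>S\<in>Pow A. (Z A S - d a) ^ 4 + (Z A S + d a) ^ 4)"
      by (rule split)
    also have "\<dots> = (\<Sum>S\<in>Pow A. 2 * (Z A S) ^ 4 + 12 * (d a)\<^sup>2 * (Z A S)\<^sup>2 + 2 * (d a) ^ 4)"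
      by (intro sum.cong refl) (simp add: power2_eq_square power4_eq_xxxx algebra_simps)
    also have "\<dots> = 2 * (\<Sum>S\<in>Pow A. (Z A S) ^ 4)
        + 12 * (d a)\<^sup>2 * (\<Sum>S\<in>Pow A. (Z A S)\<^sup>2) + 2 ^ card A * (2 * (d a) ^ 4)"
      by (simp add: sum.distrib sum_distrib_left card)
    \<comment> \<open>Enlarging the coefficient of \<open>(d a) ^ 4\<close> from 2 to 6 completes
      the square \<open>6 * ((d a)\<^sup>2 + ?M)\<^sup>2\<close>.\<close>
    also have "\<dots> \<le> 2 * (2 ^ card A * (3 * ?M\<^sup>2))
        + 12 * (d a)\<^sup>2 * (2 ^ card A * ?M) + 2 ^ card A * (6 * (d a) ^ 4)"
      using insert.IH by (intro add_mono mult_left_mono) auto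
    also have "\<dots> = 2 ^ card (insert a A) * (3 * ((d a)\<^sup>2 + ?M)\<^sup>2)"
      using insert.hyps by (simp add: power2_eq_square power4_eq_xxxx algebra_simps)
    finally show ?case
      using insert.hyps by simp
  }
qed

text \<open>A Paley-Zygmund type bound: the normalized square \<open>u\<close> has mean 1 and second
  moment at most 3, so a quadratic minorant of the indicator has mean at least (1 - 1/2)/3 - 3/42 =
  2/21.\<close>

lemma prob_signed_sum_ge:
  fixes d :: "'a \<Rightarrow> real"
  assumes "finite A"
  shows "measure_pmf.prob (pmf_of_set (Pow A))
           {S. (\<Sum>x\<in>A. (d x)\<^sup>2) / 2 \<le> (2 * sum d S - sum d A)\<^sup>2} \<ge> 2 / 21"
    (is "measure_pmf.prob _ ?G \<ge> _")
proof (cases "(\<Sum>x\<in>A. (d x)\<^sup>2) = 0")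
  case True
  then show ?thesis
    by (simp add: measure_pmf.prob_space[simplified])
next
  case False
  define M where "M = (\<Sum>x\<in>A. (d x)\<^sup>2)"
  define u where "u = (\<lambda>S. (2 * sum d S - sum d A)\<^sup>2 / M)"
  have M: "M > 0"
    using False by (simp add: M_def sum_nonneg less_le)
  \<comment> \<open>The parabola touches the constant 1 at \<open>u = 7\<close> and is negative for \<open>u < 1/2\<close>, so it
      minorizes the indicator of \<open>u \<ge> 1/2\<close>.\<close>
  have minorant: "(u S - 1 / 2) / 3 - (u S)\<^sup>2 / 42 \<le> indicat_real ?G S" for S
  proof (cases "S \<in> ?G")
    case True
    have "0 \<le> (u S - 7)\<^sup>2"
      by simp
    then show ?thesis
      using True by (simp add: power2_eq_square algebra_simps)
  next
    case F: False
    then have "u S < 1 / 2"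
      using M by (simp add: u_def M_def field_simps)
    then have "(u S - 1 / 2) / 3 - (u S)\<^sup>2 / 42 \<le> 0"
      by (smt (verit) divide_nonneg_pos divide_neg_pos zero_le_power2)
    then show ?thesis
      using F by simp
  qed
  let ?N = "2 ^ card A :: real"
  have card: "card (Pow A) = 2 ^ card A"
    using assms by (simp add: card_Pow)
  have m1: "(\<Sum>S\<in>Pow A. u S) = ?N"
    using signed_sum_second_moment[OF assms, of d] M
    by (simp add: u_def M_def flip: sum_divide_distrib)
  have "(\<Sum>S\<in>Pow A. (u S)\<^sup>2) = (\<Sum>S\<in>Pow A. (2 * sum d S - sum d A) ^ 4) / M\<^sup>2"
    by (simp add: u_def power_divide sum_divide_distrib flip: power_mult)
  also have "\<dots> \<le> (?N * (3 * M\<^sup>2)) / M\<^sup>2"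
    using signed_sum_fourth_moment[OF assms, of d] by (intro divide_right_mono) (auto simp: M_def)
  also have "\<dots> = 3 * ?N"
    using M by simp
  finally have m2: "(\<Sum>S\<in>Pow A. (u S)\<^sup>2) \<le> 3 * ?N" .
  have "2 / 21 * ?N \<le> (?N - ?N / 2) / 3 - (\<Sum>S\<in>Pow A. (u S)\<^sup>2) / 42"
    using m2 by simp
  also have "\<dots> = (\<Sum>S\<in>Pow A. (u S - 1 / 2) / 3 - (u S)\<^sup>2 / 42)"
    using m1 card by (simp add: sum_subtractf flip: sum_divide_distrib)
  also have "\<dots> \<le> (\<Sum>S\<in>Pow A. indicat_real ?G S)"
    by (intro sum_mono minorant)
  also have "\<dots> = card (Pow A \<inter> ?G)"
    using assms by (simp add: indicator_def of_bool_def sum.If_cases)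
  finally have "2 / 21 * ?N \<le> card (Pow A \<inter> ?G)" .
  then show ?thesis
    using assms by (subst measure_pmf_of_set) (auto simp: card field_simps)
qed

section \<open>Encoding of coins and independence of blocks\<close>

text \<open>Lets a single real public coin carry a whole family of subsets: the support of a pmf is
  countable, so its elements can be numbered and the numbers read as reals.\<close>

lemma real_pmf_encoding:
  fixes D :: "'a pmf"
  obtains V :: "real pmf" and dec :: "real \<Rightarrow> 'a" where "map_pmf dec V = D"
proof -
  define enc where "enc = (\<lambda>x. real (to_nat_on (set_pmf D) x))"
  define dec where "dec = (\<lambda>v::real. from_nat_into (set_pmf D) (nat \<lfloor>v\<rfloor>))"
  have "map_pmf dec (map_pmf enc D) = map_pmf id D"
    unfolding map_pmf_comp by (intro map_pmf_cong refl) (simp add: enc_def dec_def)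
  then show ?thesis
    by (intro that[of dec "map_pmf enc D"]) (simp add: pmf.map_id)
qed

lemma pair_map_pmf:
  "pair_pmf (map_pmf f M) (map_pmf g N) = map_pmf (\<lambda>(x, y). (f x, g y)) (pair_pmf M N)"
  by (simp add: pair_map_pmf1 pair_map_pmf2 map_pmf_comp apfst_def apsnd_def case_prod_unfold
      map_prod_def)

text \<open>Functions of disjoint groups of independent coordinates are independent. The induction
  splits the group of \<open>a\<close> off from \<open>J\<close>, which is why \<open>J\<close> is
  generalized; coordinates in no group are integrated out.\<close>

lemma Pi_pmf_blocks:
  assumes "finite I" "finite J" "\<And>b. b \<in> I \<Longrightarrow> B b \<subseteq> J" "disjoint_family_on B I"
    and local: "\<And>b y y'. b \<in> I \<Longrightarrow> (\<And>i. i \<in> B b \<Longrightarrow> y i = y' i) \<Longrightarrow> f b y = f b y'"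
  shows "map_pmf (\<lambda>y b. if b \<in> I then f b y else d') (Pi_pmf J d p)
       = Pi_pmf I d' (\<lambda>b. map_pmf (f b) (Pi_pmf (B b) d p))"
  using assms
proof (induction I arbitrary: J rule: finite_induct)
  case empty
  then show ?case by (simp add: map_pmf_const)
next
  case (insert a I)
  let ?g = "\<lambda>I y b. if b \<in> I then f b y else d'"
  have fin: "finite (B a)" "finite (J - B a)"
    using insert.prems(1,2) by (auto intro: finite_subset)
  have J: "J = B a \<union> (J - B a)"
    using insert.prems(2) by blast
  have disj: "B b \<inter> B a = {}" if "b \<in> I" for b
    using that insert.prems(3) insert.hyps by (fastforce simp: disjoint_family_on_def)
  have IH: "map_pmf (?g I) (Pi_pmf (J - B a) d p)
          = Pi_pmf I d' (\<lambda>b. map_pmf (f b) (Pi_pmf (B b) d p))"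
  proof (rule insert.IH)
    show "B b \<subseteq> J - B a" if "b \<in> I" for b
      using that insert.prems(2) disj by blast
    show "disjoint_family_on B I"
      using insert.prems(3) by (rule disjoint_family_on_mono[rotated]) auto
    show "f b y = f b y'" if "b \<in> I" "\<And>i. i \<in> B b \<Longrightarrow> y i = y' i" for b y y'
      using that by (intro insert.prems(4)) auto
  qed (use fin in auto)
  have "map_pmf (?g (insert a I)) (Pi_pmf J d p)
      = map_pmf (\<lambda>(x, y). ?g (insert a I) (\<lambda>i. if i \<in> B a then x i else y i))
          (pair_pmf (Pi_pmf (B a) d p) (Pi_pmf (J - B a) d p))"
    using fin by (subst J, subst Pi_pmf_union) (auto simp: map_pmf_comp case_prod_unfold)
  also have "\<dots> = map_pmf (\<lambda>(x, y). (?g I y)(a := f a x))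
          (pair_pmf (Pi_pmf (B a) d p) (Pi_pmf (J - B a) d p))"
  proof (intro map_pmf_cong refl, clarify, rule ext)
    fix x y b
    show "?g (insert a I) (\<lambda>i. if i \<in> B a then x i else y i) b = ((?g I y)(a := f a x)) b"
    proof (cases "b = a")
      case True
      have "f a (\<lambda>i. if i \<in> B a then x i else y i) = f a x"
        by (intro insert.prems(4)) auto
      then show ?thesis using True by simp
    next
      case False
      have "f b (\<lambda>i. if i \<in> B a then x i else y i) = f b y" if "b \<in> I"
        using that disj[OF that] by (intro insert.prems(4)) auto
      then show ?thesis using False by simp
    qed
  qed
  also have "\<dots> = map_pmf (\<lambda>(y, z). z(a := y))
      (pair_pmf (map_pmf (f a) (Pi_pmf (B a) d p)) (map_pmf (?g I) (Pi_pmf (J - B a) d p)))"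
    by (simp add: pair_map_pmf map_pmf_comp case_prod_unfold)
  also have "\<dots> = Pi_pmf (insert a I) d' (\<lambda>b. map_pmf (f b) (Pi_pmf (B b) d p))"
    unfolding IH using insert.hyps by (subst Pi_pmf_insert) auto
  finally show ?case .
qed

section \<open>Bernoulli bits and the private channel\<close>

lemma bool_pmf_eqI:
  fixes X Y :: "bool pmf"
  assumes "pmf X True = pmf Y True"
  shows "X = Y"
proof (rule pmf_eqI)
  fix b
  have "pmf Z False = 1 - pmf Z True" for Z :: "bool pmf"
  proof -
    have "(\<Sum>b\<in>UNIV. pmf Z b) = 1"
      by (rule sum_pmf_eq_1) auto
    then show ?thesis
      by (simp add: UNIV_bool)
  qed
  then show "pmf X b = pmf Y b"
    using assms by (cases b) auto
qed

lemma bool_pmf_eq_bernoulli: "X = bernoulli_pmf (pmf X True)"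
  by (rule bool_pmf_eqI) (simp add: pmf_le_1)

text \<open>A Bernoulli bit with random mean is a Bernoulli bit with the averaged mean. Hence a
  message, once its sample is averaged out, depends on \<open>p\<close> only through the mass of
  \<open>S\<close>.\<close>

lemma bind_bernoulli_indicator:
  assumes "0 \<le> a" "0 \<le> c" "a + c \<le> 1"
  shows "bind_pmf p (\<lambda>x. bernoulli_pmf (a + c * of_bool (x \<in> S)))
       = bernoulli_pmf (a + c * measure_pmf.prob p S)"
proof (rule bool_pmf_eqI)
  have "c * measure_pmf.prob p S \<le> c"
    using assms by (simp add: mult_left_le)
  then have r: "0 \<le> a + c * measure_pmf.prob p S" "a + c * measure_pmf.prob p S \<le> 1"
    using assms by auto
  have "pmf (bind_pmf p (\<lambda>x. bernoulli_pmf (a + c * of_bool (x \<in> S)))) True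
      = measure_pmf.expectation p (\<lambda>x. a + c * indicator S x)"
    unfolding pmf_bind using assms
    by (intro Bochner_Integration.integral_cong refl) (auto simp: indicator_def)
  also have "\<dots> = a + c * measure_pmf.prob p S"
    by (subst Bochner_Integration.integral_add)
       (auto simp: measure_pmf.prob_space[simplified] measure_pmf.emeasure_eq_measure)
  finally show "pmf (bind_pmf p (\<lambda>x. bernoulli_pmf (a + c * of_bool (x \<in> S)))) True
      = pmf (bernoulli_pmf (a + c * measure_pmf.prob p S)) True"
    using r by simp
qed

text \<open>The probability that a player holding a sample of \<open>p\<close> sends
  \<open>True\<close>, given the subset \<open>S\<close> of its block.\<close>

definition bit_bias :: "real \<Rightarrow> nat pmf \<Rightarrow> nat set \<Rightarrow> real" where
  "bit_bias \<rho> p S = 1 / 2 + \<rho> / 4 * measure_pmf.prob p S"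

lemma bit_bias_bounds:
  assumes "0 \<le> \<rho>" "\<rho> \<le> 1"
  shows "bit_bias \<rho> p S \<in> {0..1}"
proof -
  have "\<rho> / 4 * measure_pmf.prob p S \<le> 1 / 4 * 1"
    using assms by (intro mult_mono) auto
  then show ?thesis
    using assms by (simp add: bit_bias_def)
qed

text \<open>The critical ratio belongs to the message \<open>False\<close>: 1/2 against 1/2 -
  \<rho>/4. By \<open>exp \<rho> \<ge> 1 + \<rho>\<close> it reduces to
  \<open>\<rho> * \<rho> \<le> \<rho>\<close>.\<close>

lemma ldp_channel_subset_bit:
  assumes "0 < \<rho>" "\<rho> \<le> 1"
  shows "ldp_channel \<rho> X (\<lambda>x. bernoulli_pmf (1 / 2 + \<rho> / 4 * of_bool (x \<in> S)))"
proof -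
  have e: "1 + \<rho> \<le> exp \<rho>"
    by (rule exp_ge_add_one_self)
  have "\<rho> * \<rho> \<le> \<rho> * 1"
    using assms by (intro mult_left_mono) auto
  then have "1 / 2 \<le> (1 + \<rho>) * (1 / 2 - \<rho> / 4)"
    by (simp add: field_simps)
  also have "\<dots> \<le> exp \<rho> * (1 / 2 - \<rho> / 4)"
    using assms e by (intro mult_right_mono) auto
  finally have "1 / 2 \<le> exp \<rho> * (1 / 2 - \<rho> / 4)" .
  moreover from this have "1 / 2 \<le> exp \<rho> * (1 / 2 + \<rho> / 4)"
    by (rule order_trans) (use assms in \<open>auto intro!: mult_left_mono\<close>)
  moreover have "1 / 2 + \<rho> / 4 \<le> exp \<rho> * (1 / 2)"
    using assms(1) e by linarith
  moreover have "x \<le> exp \<rho> * x" if "x \<ge> 0" for x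
    using assms(1) that mult_right_mono[of 1 "exp \<rho>" x] by simp
  ultimately show ?thesis
    using assms
    by (auto simp: ldp_channel_def all_bool_eq of_bool_def)
qed

section \<open>The count test of a single block\<close>

text \<open>Here \<open>c\<close> is the number of ones in the block, compared with its mean under
  \<open>q\<close>. The test is two-sided because the sign of the difference of the masses of
  \<open>S\<close> is unknown.\<close>

definition block_rejects :: "real \<Rightarrow> nat pmf \<Rightarrow> nat \<Rightarrow> real \<Rightarrow> nat set \<Rightarrow> nat \<Rightarrow> bool" where
  "block_rejects \<rho> q m s S c \<longleftrightarrow> s \<le> \<bar>real c - real m * bit_bias \<rho> q S\<bar>"

text \<open>\<open>True\<close> means that the block rejects, opposite to the referee's convention.
  The count is binomial because the players of a block share \<open>S\<close>.\<close>

definition verdict_given_subset ::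
  "real \<Rightarrow> nat pmf \<Rightarrow> nat \<Rightarrow> real \<Rightarrow> nat pmf \<Rightarrow> nat set \<Rightarrow> bool pmf" where
  "verdict_given_subset \<rho> q m s p S =
     map_pmf (block_rejects \<rho> q m s S) (binomial_pmf m (bit_bias \<rho> p S))"

lemma pmf_map_pred: "pmf (map_pmf Q M) True = measure_pmf.prob M {x. Q x}"
  by (simp add: pmf_map vimage_def)

lemma binomial_deviation_le:
  assumes "r \<in> {0..1}" "m > 0" "s \<ge> 0" "50 * real m \<le> s\<^sup>2"
  shows "measure_pmf.prob (binomial_pmf m r) {x. s \<le> \<bar>real x - real m * r\<bar>} \<le> 1 / 50"
proof -
  interpret binomial_distribution m r
    using assms(1) by unfold_locales
  have "measure_pmf.prob (binomial_pmf m r) {x. s \<le> \<bar>real x - real m * r\<bar>}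
      \<le> 2 * exp (- 2 * s\<^sup>2 / m)"
    using prob_abs_ge[OF assms(2,3)] by simp
  also have "- 2 * s\<^sup>2 / m \<le> - 100"
    using assms by (simp add: field_simps)
  \<comment> \<open>The crude bound \<open>exp 100 \<ge> 101\<close> suffices, as 2/101 <
    1/50.\<close>
  also have "2 * exp (- 100 :: real) \<le> 1 / 50"
    using exp_ge_add_one_self[of "100 :: real"] by (simp add: exp_minus field_simps)
  finally show ?thesis by simp
qed

lemma verdict_given_subset_null:
  assumes "0 \<le> \<rho>" "\<rho> \<le> 1" "m > 0" "s \<ge> 0" "50 * real m \<le> s\<^sup>2"
  shows "pmf (verdict_given_subset \<rho> q m s q S) True \<le> 1 / 50"
  unfolding verdict_given_subset_def pmf_map_pred block_rejects_def
  using assms bit_bias_bounds by (intro binomial_deviation_le) auto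

text \<open>The mean counts under \<open>p\<close> and \<open>q\<close> differ by at least
  \<open>2 * s\<close>, so a count within \<open>s\<close> of the former is at least
  \<open>s\<close> away from the latter and is rejected.\<close>

lemma verdict_given_subset_far:
  assumes \<rho>: "0 \<le> \<rho>" "\<rho> \<le> 1" and m: "m > 0" and s: "s \<ge> 0" "50 * real m \<le> s\<^sup>2"
    and far: "2 * s \<le> real m * (\<rho> / 4) * \<bar>measure_pmf.prob p S - measure_pmf.prob q S\<bar>"
  shows "pmf (verdict_given_subset \<rho> q m s p S) True \<ge> 49 / 50"
proof -
  let ?M = "binomial_pmf m (bit_bias \<rho> p S)"
  have "real m * bit_bias \<rho> p S - real m * bit_bias \<rho> q S
      = (real m * (\<rho> / 4)) * (measure_pmf.prob p S - measure_pmf.prob q S)"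
    by (simp add: bit_bias_def algebra_simps)
  then have gap: "2 * s \<le> \<bar>real m * bit_bias \<rho> p S - real m * bit_bias \<rho> q S\<bar>"
    using far \<rho> by (simp add: abs_mult)
  have "1 - 1 / 50 \<le> 1 - measure_pmf.prob ?M {x. s \<le> \<bar>real x - real m * bit_bias \<rho> p S\<bar>}"
    using binomial_deviation_le[OF bit_bias_bounds[OF \<rho>] m s] by simp
  also have "\<dots> = measure_pmf.prob ?M (- {x. s \<le> \<bar>real x - real m * bit_bias \<rho> p S\<bar>})"
    using measure_pmf.prob_compl[of "{x. s \<le> \<bar>real x - real m * bit_bias \<rho> p S\<bar>}" ?M]
    by (simp add: Compl_eq_Diff_UNIV)
  also have "\<dots> \<le> measure_pmf.prob ?M {x. block_rejects \<rho> q m s S x}"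
    using gap by (intro measure_pmf.finite_measure_mono) (auto simp: block_rejects_def)
  finally show ?thesis
    by (simp add: verdict_given_subset_def pmf_map_pred)
qed

text \<open>Cauchy-Schwarz turns the l1 distance, above \<open>2 * \<epsilon>\<close>, into a
  squared l2 norm of at least \<open>4 * \<epsilon>\<^sup>2 / k\<close>. As \<open>p - q\<close>
  sums to zero, its signed sum is twice the difference of the masses of \<open>S\<close>.\<close>

lemma random_subset_separates:
  assumes p: "set_pmf p \<subseteq> {1..k}" and q: "set_pmf q \<subseteq> {1..k}"
    and "d_TV k p q > \<epsilon>" "\<epsilon> > 0" "k \<ge> 1"
  shows "measure_pmf.prob (pmf_of_set (Pow {1..k}))
           {S. \<epsilon>\<^sup>2 / (2 * real k) \<le> (measure_pmf.prob p S - measure_pmf.prob q S)\<^sup>2} \<ge> 2 / 21"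
proof -
  define d where "d = (\<lambda>x. pmf p x - pmf q x)"
  let ?U = "pmf_of_set (Pow {1..k})"
  have "(2 * \<epsilon>)\<^sup>2 \<le> (\<Sum>x=1..k. \<bar>d x\<bar>)\<^sup>2"
    using assms by (intro power_mono) (auto simp: d_TV_def d_def)
  also have "\<dots> \<le> (\<Sum>x=1..k. \<bar>d x\<bar>\<^sup>2) * card {1..k}"
    by (rule sum_squared_le_sum_of_squares)
  finally have l2: "4 * \<epsilon>\<^sup>2 / k \<le> (\<Sum>x=1..k. (d x)\<^sup>2)"
    using \<open>k \<ge> 1\<close> by (simp add: field_simps power_mult_distrib)
  have "sum d {1..k} = 0"
    using p q by (simp add: d_def sum_subtractf sum_pmf_eq_1)
  moreover have "sum d S = measure_pmf.prob p S - measure_pmf.prob q S" if "S \<subseteq> {1..k}" for S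
    using finite_subset[OF that] by (simp add: d_def sum_subtractf measure_measure_pmf_finite)
  ultimately have sub: "Pow {1..k} \<inter> {S. (\<Sum>x=1..k. (d x)\<^sup>2) / 2 \<le> (2 * sum d S - sum d {1..k})\<^sup>2}
      \<subseteq> {S. \<epsilon>\<^sup>2 / (2 * real k) \<le> (measure_pmf.prob p S - measure_pmf.prob q S)\<^sup>2}"
    using l2 by (auto simp: power_mult_distrib)
  have "2 / 21 \<le> measure_pmf.prob ?U
      {S. (\<Sum>x=1..k. (d x)\<^sup>2) / 2 \<le> (2 * sum d S - sum d {1..k})\<^sup>2}"
    by (rule prob_signed_sum_ge) simp
  \<comment> \<open>The inclusion \<open>sub\<close> concerns subsets of \<open>{1..k}\<close> only;
    these form the support of \<open>?U\<close>.\<close>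
  also have "\<dots> = measure_pmf.prob ?U
      (Pow {1..k} \<inter> {S. (\<Sum>x=1..k. (d x)\<^sup>2) / 2 \<le> (2 * sum d S - sum d {1..k})\<^sup>2})"
    by (intro measure_eq_AE) (auto simp: AE_measure_pmf_iff set_pmf_of_set Pow_not_empty)
  also have "\<dots> \<le> measure_pmf.prob ?U
      {S. \<epsilon>\<^sup>2 / (2 * real k) \<le> (measure_pmf.prob p S - measure_pmf.prob q S)\<^sup>2}"
    using sub by (intro measure_pmf.finite_measure_mono) auto
  finally show ?thesis .
qed

definition block_verdict :: "nat \<Rightarrow> real \<Rightarrow> nat pmf \<Rightarrow> nat \<Rightarrow> real \<Rightarrow> nat pmf \<Rightarrow> bool pmf" where
  "block_verdict k \<rho> q m s p = bind_pmf (pmf_of_set (Pow {1..k})) (verdict_given_subset \<rho> q m s p)"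

lemma block_verdict_null:
  assumes "0 \<le> \<rho>" "\<rho> \<le> 1" "m > 0" "s \<ge> 0" "50 * real m \<le> s\<^sup>2"
  shows "pmf (block_verdict k \<rho> q m s q) True \<le> 1 / 50"
  unfolding block_verdict_def pmf_bind
  using assms verdict_given_subset_null
  by (intro measure_pmf.integral_le_const measure_pmf.integrable_const_bound[where B = 1])
     (auto simp: pmf_le_1)

text \<open>A separating subset occurs with probability at least 2/21 and then leads to rejection
  with probability at least 49/50; all other subsets are bounded below by 0.\<close>

lemma block_verdict_far:
  assumes \<rho>: "0 \<le> \<rho>" "\<rho> \<le> 1" and m: "m > 0" and s: "s \<ge> 0" "50 * real m \<le> s\<^sup>2"
    and gap: "2 * s \<le> real m * (\<rho> / 4) * (\<epsilon> / sqrt (2 * real k))"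
    and pq: "set_pmf p \<subseteq> {1..k}" "set_pmf q \<subseteq> {1..k}" "d_TV k p q > \<epsilon>" "\<epsilon> > 0" "k \<ge> 1"
  shows "pmf (block_verdict k \<rho> q m s p) True \<ge> 7 / 75"
proof -
  let ?U = "pmf_of_set (Pow {1..k})"
  let ?G = "{S. \<epsilon>\<^sup>2 / (2 * real k) \<le> (measure_pmf.prob p S - measure_pmf.prob q S)\<^sup>2}"
  have good: "49 / 50 * indicat_real ?G S \<le> pmf (verdict_given_subset \<rho> q m s p S) True" for S
  proof (cases "S \<in> ?G")
    case True
    then have "sqrt (\<epsilon>\<^sup>2 / (2 * real k))
        \<le> sqrt ((measure_pmf.prob p S - measure_pmf.prob q S)\<^sup>2)"
      by (intro real_sqrt_le_mono) auto
    then have "\<epsilon> / sqrt (2 * real k) \<le> \<bar>measure_pmf.prob p S - measure_pmf.prob q S\<bar>"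
      using pq by (simp add: real_sqrt_divide)
    then have "real m * (\<rho> / 4) * (\<epsilon> / sqrt (2 * real k))
        \<le> real m * (\<rho> / 4) * \<bar>measure_pmf.prob p S - measure_pmf.prob q S\<bar>"
      using \<rho> by (intro mult_left_mono) auto
    then have "pmf (verdict_given_subset \<rho> q m s p S) True \<ge> 49 / 50"
      using gap by (intro verdict_given_subset_far \<rho> m s) linarith
    then show ?thesis
      using True by simp
  qed simp
  have "7 / 75 = 49 / 50 * (2 / 21 :: real)"
    by simp
  also have "\<dots> \<le> 49 / 50 * measure_pmf.prob ?U ?G"
    using random_subset_separates[OF pq] by (intro mult_left_mono) auto
  also have "\<dots> = measure_pmf.expectation ?U (\<lambda>S. 49 / 50 * indicat_real ?G S)"
    by simp
  also have "\<dots> \<le> measure_pmf.expectation ?U (\<lambda>S. pmf (verdict_given_subset \<rho> q m s p S) True)"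
    using good
    by (intro integral_mono measure_pmf.integrable_const_bound[where B = 1])
       (auto simp: pmf_le_1 indicator_def)
  finally show ?thesis
    by (simp add: block_verdict_def pmf_bind)
qed

section \<open>The protocol and the law of its output\<close>

text \<open>Player \<open>i\<close> belongs to block \<open>(i - 1) div m\<close>; players beyond the first \<open>T * m\<close> are ignored.\<close>

definition subset_protocol ::
  "real \<Rightarrow> nat pmf \<Rightarrow> nat \<Rightarrow> real \<Rightarrow> nat \<Rightarrow> nat \<Rightarrow> real pmf \<Rightarrow> (real \<Rightarrow> nat \<Rightarrow> nat set) \<Rightarrow>
     (real, real, bool) protocol" where
  "subset_protocol \<rho> q m s T n V dec =
     \<lparr>players = n,
      pub_law = measure_pmf V,
      priv_law = (\<lambda>_. measure_pmf (return_pmf 0)),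
      channel = (\<lambda>i v u x. bernoulli_pmf (1 / 2 + \<rho> / 4 * of_bool (x \<in> dec v ((i - 1) div m)))),
      referee = (\<lambda>y v. return_pmf (real (card {b\<in>{..<T}.
         block_rejects \<rho> q m s (dec v b) (card {i\<in>{b * m + 1..b * m + m}. y i})}) / T < 1 / 20))\<rparr>"

lemma output_prob_without_private_coins:
  assumes "pub_law P = measure_pmf V" "\<And>i. prob_space (priv_law P i)"
    and "\<And>u v. output_given P p v u = F v"
  shows "output_prob P p b = pmf (bind_pmf V F) b"
proof -
  interpret prob_space "\<Pi>\<^sub>M i\<in>{1..players P}. priv_law P i"
    using assms(2) by (rule prob_space_PiM)
  show ?thesis
    unfolding output_prob_def assms(1,3) pmf_bind by (simp add: prob_space del: One_nat_def)
qed

lemma block_decomposition: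
  assumes "T * m \<le> n" "\<And>b. b < T \<Longrightarrow> r b \<in> {0..1}" "m > 0"
  shows "map_pmf (\<lambda>y b. if b \<in> {..<T} then Q b (card {i\<in>{b * m + 1..b * m + m}. y i}) else False)
           (Pi_pmf {1..n} undefined (\<lambda>i. bernoulli_pmf (r ((i - 1) div m))))
       = Pi_pmf {..<T} False (\<lambda>b. map_pmf (Q b) (binomial_pmf m (r b)))"
proof -
  let ?B = "\<lambda>b. {b * m + 1..b * m + m}"
  let ?p = "\<lambda>i. bernoulli_pmf (r ((i - 1) div m))"
  \<comment> \<open>Players are numbered from 1 and blocks from 0, hence the shift by one.\<close>
  have idx: "(i - 1) div m = b" if "i \<in> ?B b" for i b
    using that \<open>m > 0\<close> by (intro div_nat_eqI) (auto simp: algebra_simps)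
  have "map_pmf (\<lambda>y b. if b \<in> {..<T} then Q b (card {i\<in>?B b. y i}) else False)
           (Pi_pmf {1..n} undefined ?p)
      = Pi_pmf {..<T} False
          (\<lambda>b. map_pmf (\<lambda>y. Q b (card {i\<in>?B b. y i})) (Pi_pmf (?B b) undefined ?p))"
  proof (rule Pi_pmf_blocks)
    show "?B b \<subseteq> {1..n}" if "b \<in> {..<T}" for b
    proof -
      have "b * m + m \<le> T * m"
        using that mult_le_mono1[of "Suc b" T m] by simp
      then show ?thesis
        using assms(1) by auto
    qed
    show "disjoint_family_on ?B {..<T}"
      unfolding disjoint_family_on_def using idx by (metis disjoint_iff)
    show "Q b (card {i\<in>?B b. y i}) = Q b (card {i\<in>?B b. y' i})"
      if "\<And>i. i \<in> ?B b \<Longrightarrow> y i = y' i" for b and y y' :: "nat \<Rightarrow> bool"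
    proof -
      have "{i\<in>?B b. y i} = {i\<in>?B b. y' i}"
        using that by auto
      then show ?thesis by (simp only:)
    qed
  qed auto
  also have "\<dots> = Pi_pmf {..<T} False (\<lambda>b. map_pmf (Q b) (binomial_pmf m (r b)))"
  proof (intro Pi_pmf_cong refl)
    fix b assume "b \<in> {..<T}"
    then have "binomial_pmf m (r b) = map_pmf (\<lambda>y. card {i\<in>?B b. y i})
        (Pi_pmf (?B b) undefined (\<lambda>_. bernoulli_pmf (r b)))"
      using assms by (intro binomial_pmf_altdef') auto
    also have "Pi_pmf (?B b) undefined (\<lambda>_. bernoulli_pmf (r b)) = Pi_pmf (?B b) undefined ?p"
      using idx by (intro Pi_pmf_cong) auto
    finally have eq: "binomial_pmf m (r b) = map_pmf (\<lambda>y. card {i\<in>?B b. y i})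
        (Pi_pmf (?B b) undefined ?p)" .
    show "map_pmf (\<lambda>y. Q b (card {i\<in>?B b. y i})) (Pi_pmf (?B b) undefined ?p)
        = map_pmf (Q b) (binomial_pmf m (r b))"
      unfolding eq map_pmf_comp ..
  qed
  finally show ?thesis .
qed

lemma output_given_subset_protocol:
  assumes \<rho>: "0 \<le> \<rho>" "\<rho> \<le> 1" and "m > 0" "T * m \<le> n"
  shows "output_given (subset_protocol \<rho> q m s T n V dec) p v u
       = map_pmf (\<lambda>z. real (card {b\<in>{..<T}. z b}) / T < 1 / 20)
           (Pi_pmf {..<T} False (\<lambda>b. verdict_given_subset \<rho> q m s p (dec v b)))"
proof -
  let ?acc = "\<lambda>z. real (card {b\<in>{..<T}. z b}) / T < 1 / 20"
  let ?Q = "\<lambda>b. block_rejects \<rho> q m s (dec v b)"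
  let ?h = "\<lambda>y b. if b \<in> {..<T} then ?Q b (card {i\<in>{b * m + 1..b * m + m}. y i}) else False"
  have "output_given (subset_protocol \<rho> q m s T n V dec) p v u
      = bind_pmf (Pi_pmf {1..n} undefined (\<lambda>i. bind_pmf p
          (\<lambda>x. bernoulli_pmf (1 / 2 + \<rho> / 4 * of_bool (x \<in> dec v ((i - 1) div m))))))
          (\<lambda>y. return_pmf (?acc (?h y)))"
    \<comment> \<open>Drawing all samples and then all messages amounts to drawing each message from
      its own mixture; \<open>undefined\<close> is the default of the sample vector in
      \<open>output_given\<close>.\<close>
    by (subst Pi_pmf_bind[where d' = undefined])
       (auto simp: output_given_def subset_protocol_def bind_assoc_pmf cong: conj_cong)
  also have "(\<lambda>i. bind_pmf p
          (\<lambda>x. bernoulli_pmf (1 / 2 + \<rho> / 4 * of_bool (x \<in> dec v ((i - 1) div m)))))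
      = (\<lambda>i. bernoulli_pmf (bit_bias \<rho> p (dec v ((i - 1) div m))))"
    using \<rho> unfolding bit_bias_def by (intro ext bind_bernoulli_indicator) auto
  also have "bind_pmf (Pi_pmf {1..n} undefined \<dots>) (\<lambda>y. return_pmf (?acc (?h y)))
      = map_pmf ?acc (map_pmf ?h (Pi_pmf {1..n} undefined
          (\<lambda>i. bernoulli_pmf (bit_bias \<rho> p (dec v ((i - 1) div m))))))"
    unfolding map_pmf_comp by (rule map_pmf_def[symmetric])
  also have "\<dots> = map_pmf ?acc (Pi_pmf {..<T} False (\<lambda>b. verdict_given_subset \<rho> q m s p (dec v b)))"
    using assms bit_bias_bounds[OF \<rho>] unfolding verdict_given_subset_def
    by (subst block_decomposition[where r = "\<lambda>b. bit_bias \<rho> p (dec v b)"]) auto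
  finally show ?thesis .
qed

text \<open>The subsets of the blocks are independent, so averaging over the public coin makes the
  verdicts i.i.d. and the number of rejecting blocks binomial.\<close>

lemma output_prob_subset_protocol:
  assumes "0 \<le> \<rho>" "\<rho> \<le> 1" "m > 0" "T * m \<le> n"
    and V: "map_pmf dec V = Pi_pmf {..<T} {} (\<lambda>_. pmf_of_set (Pow {1..k}))"
  shows "output_prob (subset_protocol \<rho> q m s T n V dec) p b
       = pmf (map_pmf (\<lambda>c. real c / T < 1 / 20)
           (binomial_pmf T (pmf (block_verdict k \<rho> q m s p) True))) b"
proof -
  let ?acc = "\<lambda>z. real (card {b\<in>{..<T}. z b}) / T < 1 / 20"
  let ?r = "pmf (block_verdict k \<rho> q m s p) True"
  have "output_prob (subset_protocol \<rho> q m s T n V dec) p b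
      = pmf (bind_pmf V (\<lambda>v. map_pmf ?acc
          (Pi_pmf {..<T} False (\<lambda>b. verdict_given_subset \<rho> q m s p (dec v b))))) b"
    using assms(1-4)
    by (intro output_prob_without_private_coins output_given_subset_protocol)
       (auto simp: subset_protocol_def measure_pmf.prob_space_axioms)
  also have "bind_pmf V (\<lambda>v. map_pmf ?acc
          (Pi_pmf {..<T} False (\<lambda>b. verdict_given_subset \<rho> q m s p (dec v b))))
      = map_pmf ?acc (bind_pmf (map_pmf dec V)
          (\<lambda>S. Pi_pmf {..<T} False (\<lambda>b. verdict_given_subset \<rho> q m s p (S b))))"
    by (simp add: map_bind_pmf bind_map_pmf)
  also have "\<dots> = map_pmf ?acc (Pi_pmf {..<T} False (\<lambda>_. block_verdict k \<rho> q m s p))"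
    unfolding V block_verdict_def by (subst Pi_pmf_bind[where d' = "{}"]) auto
  also have "block_verdict k \<rho> q m s p = bernoulli_pmf ?r"
    by (rule bool_pmf_eq_bernoulli)
  also have "map_pmf ?acc (Pi_pmf {..<T} False (\<lambda>_. bernoulli_pmf ?r))
      = map_pmf (\<lambda>c. real c / T < 1 / 20) (binomial_pmf T ?r)"
    by (subst binomial_pmf_altdef'[of "{..<T}" T _ False]) (auto simp: map_pmf_comp pmf_le_1)
  finally show ?thesis .
qed

lemma public_coin_ldp_subset_protocol:
  assumes "0 < \<rho>" "\<rho> \<le> 1"
  shows "public_coin_ldp_protocol k \<rho> (subset_protocol \<rho> q m s T n V dec)"
proof -
  \<comment> \<open>Message probabilities depend on the public coin alone, so joint measurability
    comes from the first projection.\<close>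
  have "(\<lambda>z. f (fst z)) \<in> borel_measurable (measure_pmf V \<Otimes>\<^sub>M measure_pmf N)"
    for f :: "real \<Rightarrow> real" and N :: "real pmf"
    by (rule measurable_compose[OF measurable_fst]) simp
  then show ?thesis
    by (simp add: ldp_channel_subset_bit[OF assms] public_coin_ldp_protocol_def
        subset_protocol_def case_prod_unfold measure_pmf.prob_space_axioms del: times_divide_eq_left)
qed

text \<open>The threshold 1/20 equals 1/50 + 3/100 and lies below 7/75 - 3/100. Hoeffding's
  inequality with slack 3/100 therefore bounds both errors by
  \<open>exp (- real T * (9 / 5000))\<close>.\<close>

lemma solves_identity_testing_subset_protocol:
  assumes \<rho>: "0 \<le> \<rho>" "\<rho> \<le> 1" and m: "m > 0" "T * m \<le> n"
    and s: "s \<ge> 0" "50 * real m \<le> s\<^sup>2"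
      "2 * s \<le> real m * (\<rho> / 4) * (\<epsilon> / sqrt (2 * real k))"
    and V: "map_pmf dec V = Pi_pmf {..<T} {} (\<lambda>_. pmf_of_set (Pow {1..k}))"
    and q: "set_pmf q \<subseteq> {1..k}" and k: "k \<ge> 1" and \<epsilon>: "\<epsilon> > 0" and \<delta>: "\<delta> > 0"
    and T: "T > 0" "real T * (9 / 5000) > ln (1 / \<delta>)"
  shows "solves_identity_testing k \<epsilon> \<delta> q (subset_protocol \<rho> q m s T n V dec)"
proof -
  have "exp (- (real T * (9 / 5000))) < exp (ln \<delta>)"
    using T \<delta> by (simp add: ln_div del: exp_ln)
  then have tail: "exp (- 2 * real T * (3 / 100)\<^sup>2) < \<delta>"
    using \<delta> by (simp add: power2_eq_square mult.commute)
  have compl: "pmf (map_pmf Q M) b = 1 - measure_pmf.prob M {c. Q c \<noteq> b}"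
    for Q :: "nat \<Rightarrow> bool" and M b
    using measure_pmf.prob_compl[of "{c. Q c \<noteq> b}" M]
    by (simp add: pmf_map vimage_def Compl_eq_Diff_UNIV[symmetric] Collect_neg_eq[symmetric])
  let ?r = "\<lambda>p. pmf (block_verdict k \<rho> q m s p) True"
  have loc: "binomial_distribution (?r p)" for p
    by unfold_locales (auto simp: pmf_le_1)
  have "measure_pmf.prob (binomial_pmf T (?r q)) {c. (real c / T < 1 / 20) \<noteq> True}
      \<le> measure_pmf.prob (binomial_pmf T (?r q)) {c. real c / T \<ge> ?r q + 3 / 100}"
    using block_verdict_null[OF \<rho> m(1) s(1,2), of k q]
    by (intro measure_pmf.finite_measure_mono) auto
  also have "\<dots> \<le> exp (- 2 * real T * (3 / 100)\<^sup>2)"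
    using binomial_distribution.prob_ge'[OF loc T(1), of "3 / 100" q] by simp
  finally have accept: "output_prob (subset_protocol \<rho> q m s T n V dec) q True > 1 - \<delta>"
    unfolding output_prob_subset_protocol[OF \<rho> m V] compl using tail by linarith
  have "output_prob (subset_protocol \<rho> q m s T n V dec) p False > 1 - \<delta>"
    if p: "set_pmf p \<subseteq> {1..k}" "d_TV k p q > \<epsilon>" for p
  proof -
    have "measure_pmf.prob (binomial_pmf T (?r p)) {c. (real c / T < 1 / 20) \<noteq> False}
        \<le> measure_pmf.prob (binomial_pmf T (?r p)) {c. real c / T \<le> ?r p - 3 / 100}"
      using block_verdict_far[OF \<rho> m(1) s p(1) q p(2) \<epsilon> k]
      by (intro measure_pmf.finite_measure_mono) auto
    also have "\<dots> \<le> exp (- 2 * real T * (3 / 100)\<^sup>2)"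
      using binomial_distribution.prob_le'[OF loc T(1), of "3 / 100" p] by simp
    finally show ?thesis
      unfolding output_prob_subset_protocol[OF \<rho> m V] compl using tail by linarith
  qed
  with accept show ?thesis
    by (simp add: solves_identity_testing_def)
qed

section \<open>The fair coin for large \<delta>\<close>

definition coin_protocol :: "nat \<Rightarrow> (real, real, bool) protocol" where
  "coin_protocol n =
     \<lparr>players = n,
      pub_law = measure_pmf (return_pmf 0),
      priv_law = (\<lambda>_. measure_pmf (return_pmf 0)),
      channel = (\<lambda>i v u x. return_pmf True),
      referee = (\<lambda>y v. bernoulli_pmf (1 / 2))\<rparr>"

lemma public_coin_ldp_coin_protocol:
  assumes "0 \<le> \<rho>"
  shows "public_coin_ldp_protocol k \<rho> (coin_protocol n)"
proof -
  have "1 * pmf (return_pmf True) y \<le> exp \<rho> * pmf (return_pmf True) y" for y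
    using assms by (intro mult_right_mono) auto
  then show ?thesis
    by (auto simp: public_coin_ldp_protocol_def coin_protocol_def ldp_channel_def
        measure_pmf.prob_space_axioms)
qed

lemma solves_identity_testing_coin_protocol:
  assumes "\<delta> > 1 / 2"
  shows "solves_identity_testing k \<epsilon> \<delta> q (coin_protocol n)"
proof -
  have "output_prob (coin_protocol n) p b
      = pmf (bind_pmf (return_pmf (0 :: real)) (\<lambda>_. bernoulli_pmf (1 / 2))) b" for p b
    by (intro output_prob_without_private_coins)
       (auto simp: coin_protocol_def output_given_def measure_pmf.prob_space_axioms)
  then have "output_prob (coin_protocol n) p b = 1 / 2" for p b
    by simp
  then show ?thesis
    using assms unfolding solves_identity_testing_def by (simp only:) linarith
qed

section \<open>Choice of the constants\<close>

theorem theorem4: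
  shows "\<exists>C::real. C > 0 \<and>
    (\<forall>(k::nat) (\<rho>::real) (\<epsilon>::real) (\<delta>::real) (q::nat pmf).
       k \<ge> 1 \<longrightarrow> 0 < \<rho> \<longrightarrow> \<rho> \<le> 1 \<longrightarrow> 0 < \<epsilon> \<longrightarrow> \<epsilon> \<le> 1 \<longrightarrow> 0 < \<delta> \<longrightarrow> \<delta> < 1 \<longrightarrow>
       set_pmf q \<subseteq> {1..k} \<longrightarrow>
       (\<exists>P :: (real, real, bool) protocol.
          players P = nat \<lceil>C * (real k / (\<epsilon>\<^sup>2 * \<rho>\<^sup>2)) * ln (1 / \<delta>)\<rceil> \<and>
          public_coin_ldp_protocol k \<rho> P \<and>
          solves_identity_testing k \<epsilon> \<delta> q P))"
proof (intro exI[of _ "6401 * 602"] conjI allI impI)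
  fix k :: nat and \<rho> \<epsilon> \<delta> :: real and q :: "nat pmf"
  assume k: "k \<ge> 1" and \<rho>: "0 < \<rho>" "\<rho> \<le> 1" and \<epsilon>: "0 < \<epsilon>" "\<epsilon> \<le> 1" and \<delta>: "0 < \<delta>" "\<delta> < 1"
    and q: "set_pmf q \<subseteq> {1..k}"
  define A where "A = real k / (\<epsilon>\<^sup>2 * \<rho>\<^sup>2)"
  define L where "L = ln (1 / \<delta>)"
  define n where "n = nat \<lceil>6401 * 602 * A * L\<rceil>"
  show "\<exists>P :: (real, real, bool) protocol.
          players P = nat \<lceil>6401 * 602 * (real k / (\<epsilon>\<^sup>2 * \<rho>\<^sup>2)) * ln (1 / \<delta>)\<rceil> \<and>
          public_coin_ldp_protocol k \<rho> P \<and> solves_identity_testing k \<epsilon> \<delta> q P"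
    unfolding A_def[symmetric] L_def[symmetric] n_def[symmetric]
  proof (cases "\<delta> > 1 / 2")
    case True
    have "players (coin_protocol n) = n"
      by (simp add: coin_protocol_def)
    then show "\<exists>P :: (real, real, bool) protocol. players P = n \<and>
        public_coin_ldp_protocol k \<rho> P \<and> solves_identity_testing k \<epsilon> \<delta> q P"
      using True \<rho> public_coin_ldp_coin_protocol solves_identity_testing_coin_protocol
      by (intro exI[of _ "coin_protocol n"]) simp
  next
    case False
    \<comment> \<open>With \<open>s\<close> as below, \<open>s\<^sup>2\<close> is
      \<open>m * m / (128 * A)\<close>, so \<open>50 * m \<le> s\<^sup>2\<close> asks for
      \<open>m\<close> at least 50 * 128 * \<open>A\<close>. For \<open>T\<close>, 600 * 9/5000 =
      1.08 exceeds 1.\<close>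
    define m where "m = nat \<lceil>6400 * A\<rceil>"
    define T where "T = nat \<lceil>600 * L\<rceil>"
    define \<Delta> where "\<Delta> = \<epsilon> / sqrt (2 * real k)"
    \<comment> \<open>Half of \<open>m * (\<rho> / 4) * \<Delta>\<close>, the least shift of the
      mean count caused by a separating subset.\<close>
    define s where "s = real m * \<rho> * \<Delta> / 8"
    have "\<epsilon>\<^sup>2 * \<rho>\<^sup>2 \<le> 1 * 1"
      using \<rho> \<epsilon> by (intro mult_mono power_le_one) auto
    then have A: "A \<ge> 1"
      using k \<rho> \<epsilon> by (simp add: A_def)
    have "1 / 2 \<le> ln (2 :: real)"
      using ln2_ge_two_thirds by simp
    also have "\<dots> \<le> L"
      using False \<delta> by (simp add: L_def field_simps)
    finally have L: "L \<ge> 1 / 2" .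
    \<comment> \<open>Rounding up adds at most 1, which is at most \<open>A\<close> and at most
      \<open>2 * L\<close>; the latter relies on \<open>\<delta> \<le> 1 / 2\<close>.\<close>
    have m: "6400 * A \<le> m" "m \<le> 6401 * A" and T: "600 * L \<le> T" "T \<le> 602 * L"
      unfolding m_def T_def using A L by linarith+
    have "real (T * m) \<le> (602 * L) * (6401 * A)"
      unfolding of_nat_mult using m T A L by (intro mult_mono) auto
    also have "\<dots> \<le> n"
      unfolding n_def using real_nat_ceiling_ge[of "6401 * 602 * A * L"] by (simp add: mult_ac)
    finally have Tm: "T * m \<le> n"
      by (simp only: of_nat_le_iff)
    have "50 * real m = real m * (6400 * A) / (128 * A)"
      using A by simp
    also have "\<dots> \<le> real m * real m / (128 * A)"
      using m A by (intro divide_right_mono mult_left_mono) auto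
    also have "\<dots> = s\<^sup>2"
      using k \<rho> \<epsilon> by (simp add: s_def \<Delta>_def A_def power_divide power_mult_distrib power2_eq_square)
    finally have s2: "50 * real m \<le> s\<^sup>2" .
    obtain V :: "real pmf" and dec
      where V: "map_pmf dec V = Pi_pmf {..<T} {} (\<lambda>_. pmf_of_set (Pow {1..k}))"
      using real_pmf_encoding by blast
    have "solves_identity_testing k \<epsilon> \<delta> q (subset_protocol \<rho> q m s T n V dec)"
    proof (rule solves_identity_testing_subset_protocol)
      show "2 * s \<le> real m * (\<rho> / 4) * (\<epsilon> / sqrt (2 * real k))"
        by (simp add: s_def \<Delta>_def mult_ac)
      show "ln (1 / \<delta>) < real T * (9 / 5000)"
        using T L by (simp add: L_def)
      show "s \<ge> 0"
        using \<rho> \<epsilon> by (simp add: s_def \<Delta>_def)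
      show "m > 0" "T > 0"
        using m T A L by linarith+
    qed (use \<rho> \<epsilon> \<delta> k q V Tm s2 in auto)
    moreover have "players (subset_protocol \<rho> q m s T n V dec) = n"
      by (simp add: subset_protocol_def)
    ultimately show "\<exists>P :: (real, real, bool) protocol. players P = n \<and>
        public_coin_ldp_protocol k \<rho> P \<and> solves_identity_testing k \<epsilon> \<delta> q P"
      using public_coin_ldp_subset_protocol[OF \<rho>] by blast
  qed
qed simp

end
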